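(* Let $n\ge 2$, let $\bm X=(X_1,\dots,X_n)$ and $Y$ be random variables with finite alphabets $\mathcal X_1,\dots,\mathcal X_n,\mathcal Y$ and joint distribution $p(\bm X,Y)$, and for each $m\ge1$ let $\mathcal S_m=\{(\bm x^{(k)},y^{(k)})\}_{k=1}^m$ be a set of $m$ i.i.d. samples from $p$. Then, as $m\to\infty$, $$\frac1m\,\lambda_{\mathcal C_{\mathrm H}}^{\mathcal C_{\mathrm T}}(\mathcal S_m)\longrightarrow \mathrm{RSI}(\bm X;Y)\quad\text{in probability.}$$
   Context: The redundancy-synergy index is $\mathrm{RSI}(\bm X;Y)=\sum_{j=1}^n I(X_j;Y)-I(\bm X;Y)$, with $I$ the Shannon mutual information (natural logarithms, or the same base as used for $\log$ below). Classes of joint probability distributions on $\mathcal X_1\times\dots\times\mathcal X_n\times\mathcal Y$: the tail-to-tail class $$\mathcal C_{\mathrm T}=\Big\{q: q(\bm X,Y)=q(Y)\prod_{j=1}^n q(X_j\mid Y)\Big\}$$ (all distributions under which $X_1,\dots,X_n$ are conditionally independent given $Y$), and the head-to-head class $$\mathcal C_{\mathrm H}=\Big\{q: q(\bm X,Y)=q(Y\mid\bm X)\prod_{j=1}^n q(X_j)\Big\}$$ (all distributions under which $X_1,\dots,X_n$ are mutually independent, with $Y$ depending arbitrarily on them). The likelihood of a distribution $q$ on the sample is $\Lambda(\mathcal S_m;q)=\prod_{k=1}^m q(\bm x^{(k)},y^{(k)})$, and the generalized likelihood ratio between classes $\mathcal C,\mathcal C'$ is $$\lambda_{\mathcal C'}^{\mathcal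 C}(\mathcal S_m)=\log\frac{\sup_{r\in\mathcal C}\Lambda(\mathcal S_m;r)}{\sup_{s\in\mathcal C'}\Lambda(\mathcal S_m;s)}.$$ *)

theory Defs
  imports "HOL-Probability.Probability"
begin

definition (in information_space) rsi ::
  "nat \<Rightarrow> (nat \<Rightarrow> 'a \<Rightarrow> 'c) \<Rightarrow> ('a \<Rightarrow> 'd) \<Rightarrow> real" where
  "rsi n X Y = (\<Sum>j = 1..n. \<I>(X j ; Y)) - \<I>((\<lambda>\<omega>. \<lambda>j\<in>{1..n}. X j \<omega>) ; Y)"

(* The alphabets of X_1, ..., X_n are subsets A 1, ..., A n of one type; they may differ. *)
definition joint_alphabet :: "nat \<Rightarrow> (nat \<Rightarrow> 'a set) \<Rightarrow> 'b set \<Rightarrow> ((nat \<Rightarrow> 'a) \<times> 'b) set" where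
  "joint_alphabet n A B = (\<Pi>\<^sub>E j\<in>{1..n}. A j) \<times> B"

(* A conditional probability given a null event is 0 here. If q(y) = 0, then both sides of the
   factorization below are 0 whatever value q(x_j | y) is given, so nothing depends on this. *)
definition class_T :: "nat \<Rightarrow> (nat \<Rightarrow> 'a set) \<Rightarrow> 'b set \<Rightarrow> ((nat \<Rightarrow> 'a) \<times> 'b) pmf set" where
  "class_T n A B = {q. set_pmf q \<subseteq> joint_alphabet n A B \<and>
     (\<forall>(x, y)\<in>joint_alphabet n A B.
        pmf q (x, y) = \<P>(z in measure_pmf q. snd z = y) *
          (\<Prod>j = 1..n. \<P>(z in measure_pmf q. fst z j = x j \<bar> snd z = y)))}"

(* Here an x with q(x) = 0 imposes no condition by itself, but the equations at the other x, and
   the fact that the product of the marginals has total mass 1, still force independence: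
   see class_H_iff_independent. *)
definition class_H :: "nat \<Rightarrow> (nat \<Rightarrow> 'a set) \<Rightarrow> 'b set \<Rightarrow> ((nat \<Rightarrow> 'a) \<times> 'b) pmf set" where
  "class_H n A B = {q. set_pmf q \<subseteq> joint_alphabet n A B \<and>
     (\<forall>(x, y)\<in>joint_alphabet n A B.
        pmf q (x, y) = \<P>(z in measure_pmf q. snd z = y \<bar> fst z = x) *
          (\<Prod>j = 1..n. \<P>(z in measure_pmf q. fst z j = x j)))}"

definition likelihood :: "nat \<Rightarrow> (nat \<Rightarrow> 'c) \<Rightarrow> 'c pmf \<Rightarrow> real" where
  "likelihood m s q = (\<Prod>k = 1..m. pmf q (s k))"

(* Likelihoods lie in [0, 1], so for nonempty classes the real suprema are the true ones. *)
definition gen_log_likelihood_ratio ::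
  "real \<Rightarrow> 'c pmf set \<Rightarrow> 'c pmf set \<Rightarrow> nat \<Rightarrow> (nat \<Rightarrow> 'c) \<Rightarrow> real" where
  "gen_log_likelihood_ratio b C C' m s =
     log b ((SUP r\<in>C. likelihood m s r) / (SUP r\<in>C'. likelihood m s r))"

(* The m-th variable may live on its own probability space N m. Meant for measurable Z m: measure is
   0 on non-measurable sets. *)
definition tendsto_in_probability ::
  "(nat \<Rightarrow> 'a measure) \<Rightarrow> (nat \<Rightarrow> 'a \<Rightarrow> real) \<Rightarrow> real \<Rightarrow> bool" where
  "tendsto_in_probability N Z c \<longleftrightarrow>
     (\<forall>\<epsilon>>0. (\<lambda>m. \<P>(\<omega> in N m. \<bar>Z m \<omega> - c\<bar> > \<epsilon>)) \<longlonglongrightarrow> 0)"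

lemma class_H_iff_independent:
  assumes finA: "\<And>j. j \<in> {1..n} \<Longrightarrow> finite (A j)" and finB: "finite B"
    and supp: "set_pmf q \<subseteq> joint_alphabet n A B"
  shows "q \<in> class_H n A B \<longleftrightarrow>
    (\<forall>x\<in>\<Pi>\<^sub>E j\<in>{1..n}. A j. \<P>(z in measure_pmf q. fst z = x) =
       (\<Prod>j = 1..n. \<P>(z in measure_pmf q. fst z j = x j)))"
proof -
  define P where "P = (\<Pi>\<^sub>E j\<in>{1..n}. A j)"
  define a where "a x = \<P>(z in measure_pmf q. fst z = x)" for x
  define g where "g j c = \<P>(z in measure_pmf q. fst z j = c)" for j c
  define f where "f x = (\<Prod>j = 1..n. g j (x j))" for x
  have finP: "finite P" unfolding P_def using finA by (intro finite_PiE) auto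
  have supp': "fst z \<in> P" "snd z \<in> B" if "z \<in> set_pmf q" for z
    using supp that by (cases z; force simp: joint_alphabet_def P_def)+
  have marg: "(\<Sum>c\<in>C. \<P>(z in measure_pmf q. h z = c)) = 1"
    if "finite C" "\<And>z. z \<in> set_pmf q \<Longrightarrow> h z \<in> C" for C and h :: "_ \<Rightarrow> 'e"
  proof -
    have "(\<Sum>c\<in>C. \<P>(z in measure_pmf q. h z = c)) = (\<Sum>c\<in>C. pmf (map_pmf h q) c)"
      by (intro sum.cong refl) (auto simp: pmf_map vimage_def)
    also have "\<dots> = 1"
      using that by (intro sum_pmf_eq_1) auto
    finally show ?thesis .
  qed
  have sum_a: "(\<Sum>x\<in>P. a x) = 1"
    unfolding a_def by (intro marg finP supp')
  have "(\<Sum>x\<in>P. f x) = (\<Prod>j = 1..n. \<Sum>c\<in>A j. g j c)"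
    unfolding f_def P_def using finA by (subst prod_sum_PiE) auto
  also have "\<dots> = (\<Prod>j = 1..n. 1)"
    unfolding g_def using finA supp'(1)
    by (intro prod.cong refl marg) (auto simp: P_def PiE_iff)
  finally have sum_f: "(\<Sum>x\<in>P. f x) = 1" by simp
  have f_nonneg: "f x \<ge> 0" for x unfolding f_def g_def by (auto intro!: prod_nonneg)
  have pmf_a: "(\<Sum>y\<in>B. pmf q (x, y)) = a x" for x
  proof -
    have "(\<Sum>y\<in>B. pmf q (x, y)) = (\<Sum>z\<in>Pair x ` B. pmf q z)"
      by (subst sum.reindex) (auto simp: inj_on_def)
    also have "\<dots> = measure (measure_pmf q) (Pair x ` B)"
      using finB by (simp add: measure_measure_pmf_finite)
    also have "\<dots> = a x"
      unfolding a_def using supp'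
      by (intro measure_pmf.finite_measure_eq_AE) (auto simp: AE_measure_pmf_iff image_iff)
    finally show ?thesis .
  qed
  have cond: "\<P>(z in measure_pmf q. snd z = y \<bar> fst z = x) = pmf q (x, y) / a x" for x y
  proof -
    have "{z. snd z = y \<and> fst z = x} = {(x, y)}" by auto
    then show ?thesis by (simp add: cond_prob_def a_def measure_pmf_single)
  qed
  have H: "q \<in> class_H n A B \<longleftrightarrow> (\<forall>x\<in>P. \<forall>y\<in>B. pmf q (x, y) = pmf q (x, y) / a x * f x)"
    using supp unfolding class_H_def mem_Collect_eq cond f_def g_def
    by (auto simp: joint_alphabet_def P_def)
  have "(\<forall>x\<in>P. a x = f x)" if "q \<in> class_H n A B"
  proof -
    have le: "a x \<le> f x" if x: "x \<in> P" for x
    proof (cases "a x = 0")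
      case False
      have "a x = (\<Sum>y\<in>B. pmf q (x, y) / a x * f x)"
        using \<open>q \<in> class_H n A B\<close> x unfolding H by (subst pmf_a [symmetric]) (auto intro!: sum.cong)
      also have "\<dots> = (\<Sum>y\<in>B. pmf q (x, y)) / a x * f x"
        by (simp add: sum_distrib_right sum_divide_distrib)
      also have "\<dots> = f x" using False by (simp add: pmf_a)
      finally show ?thesis by simp
    qed (use f_nonneg in simp)
    have "(\<Sum>x\<in>P. f x - a x) = 0" by (simp add: sum_subtractf sum_a sum_f)
    then show ?thesis
      using le finP by (subst (asm) sum_nonneg_eq_0_iff) auto
  qed
  moreover have "q \<in> class_H n A B" if eq: "\<forall>x\<in>P. a x = f x"
    unfolding H
  proof (intro ballI)
    fix x y assume xy: "x \<in> P" "y \<in> B"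
    have "pmf q (x, y) \<le> a x"
      unfolding pmf_a [symmetric] using finB xy by (intro member_le_sum) auto
    then show "pmf q (x, y) = pmf q (x, y) / a x * f x"
      using eq xy by (cases "a x = 0") (auto intro: antisym)
  qed
  ultimately show ?thesis unfolding a_def f_def g_def P_def by blast
qed

end

theory Submission
  imports Defs "HOL-Real_Asymp.Real_Asymp"
begin

text \<open>
  Both likelihoods factor into products of conditional probabilities. By AM-GM, the product of
  \<open>r(g | h)\<close> along the sample is largest when \<open>r\<close> is the empirical distribution \<open>E\<close>. All factors
  are maximised at once by \<open>E(y) \<Prod>\<^sub>j E(x\<^sub>j | y)\<close> in the class T and by \<open>E(y | x) \<Prod>\<^sub>j E(x\<^sub>j)\<close> in the
  class H, so the normalised log-likelihood ratio is exactly the redundancy-synergy index of \<open>E\<close>.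
  That index is a signed sum of entropies of marginals, hence continuous in the point masses,
  which concentrate around those of \<open>p\<close> by Hoeffding's inequality.
\<close>

section \<open>Maximum likelihood for conditional probabilities\<close>

text \<open>AM-GM for the ratios \<open>u k / v k\<close>: their mean is at most 1, hence so is
  their product. The inequality \<open>t \<le> exp (t - 1)\<close> turns the product into the
  exponential of a sum. Over an infinite \<open>K\<close> both products are 1.\<close>

lemma prod_le_of_sum_ratio_le:
  fixes u v :: "'k \<Rightarrow> real"
  assumes "\<And>k. k \<in> K \<Longrightarrow> 0 \<le> u k" "\<And>k. k \<in> K \<Longrightarrow> 0 < v k"
    and "(\<Sum>k\<in>K. u k / v k) \<le> card K"
  shows "prod u K \<le> prod v K"
proof (cases "finite K")
  case fin: True
  have "(\<Prod>k\<in>K. u k / v k) \<le> (\<Prod>k\<in>K. exp (u k / v k - 1))"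
  proof (intro prod_mono conjI)
    fix k assume "k \<in> K"
    then show "0 \<le> u k / v k" using assms(1,2)[of k] by simp
    show "u k / v k \<le> exp (u k / v k - 1)"
      using exp_ge_add_one_self[of "u k / v k - 1"] by simp
  qed
  also have "\<dots> = exp ((\<Sum>k\<in>K. u k / v k) - card K)"
    using fin by (simp add: exp_sum [symmetric] sum_subtractf)
  also have "\<dots> \<le> 1" using assms(3) by simp
  finally have "prod u K / prod v K \<le> 1" by (simp add: prod_dividef)
  moreover have "prod v K > 0" using assms(2) by (intro prod_pos) auto
  ultimately show ?thesis by (simp add: divide_le_eq)
qed auto

text \<open>As the image of the uniform law on the indices, it commutes with \<open>map_pmf\<close>:
  marginals of an empirical law are empirical laws of the mapped sample. For \<open>m = 0\<close>
  the value is unspecified.\<close>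

definition empirical :: "nat \<Rightarrow> (nat \<Rightarrow> 'c) \<Rightarrow> 'c pmf" where
  "empirical m s = map_pmf s (pmf_of_set {1..m})"

lemma map_pmf_empirical: "map_pmf f (empirical m s) = empirical m (\<lambda>k. f (s k))"
  by (simp add: empirical_def map_pmf_comp)

lemma set_pmf_empirical: "m \<ge> 1 \<Longrightarrow> set_pmf (empirical m s) = s ` {1..m}"
  by (simp add: empirical_def)

lemma pmf_empirical_pos: "k \<in> {1..m} \<Longrightarrow> pmf (empirical m s) (s k) > 0"
  by (intro pmf_positive) (auto simp: set_pmf_empirical)

text \<open>Both sides are \<open>m\<close> times the expectation of \<open>f\<close> under the
  empirical law. Unobserved points of \<open>C\<close> have mass 0.\<close>

lemma sum_eq_empirical:
  fixes f :: "'c \<Rightarrow> real"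
  assumes "m \<ge> 1" "finite C" "s ` {1..m} \<subseteq> C"
  shows "(\<Sum>k=1..m. f (s k)) = m * (\<Sum>c\<in>C. pmf (empirical m s) c * f c)"
proof -
  have "(\<Sum>k=1..m. f (s k)) / m = measure_pmf.expectation (empirical m s) f"
    using assms(1) by (simp add: empirical_def integral_pmf_of_set)
  also have "\<dots> = (\<Sum>c\<in>C. pmf (empirical m s) c * f c)"
    using assms by (subst integral_measure_pmf[of C]) (auto simp: set_pmf_empirical)
  finally show ?thesis using assms(1) by (simp add: field_simps)
qed

lemma pmf_empirical:
  assumes "m \<ge> 1"
  shows "pmf (empirical m s) d = (\<Sum>k=1..m. indicator {d} (s k)) / m"
proof -
  \<comment> \<open>\<open>d\<close> need not occur in the sample, so it is added to the points
    summed over.\<close>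
  have "(\<Sum>k=1..m. indicator {d} (s k)) =
      m * (\<Sum>c\<in>insert d (s ` {1..m}). pmf (empirical m s) c * indicator {d} c)"
    using assms by (intro sum_eq_empirical) auto
  also have "(\<Sum>c\<in>insert d (s ` {1..m}). pmf (empirical m s) c * indicator {d} c) =
      (\<Sum>c\<in>{d}. pmf (empirical m s) c * indicator {d} c)"
    by (rule sum.mono_neutral_right) auto
  finally show ?thesis using assms by simp
qed

lemma sum_pmf_fibre_le:
  assumes "finite F" "\<And>d. d \<in> F \<Longrightarrow> h d = y"
  shows "(\<Sum>d\<in>F. pmf r d) \<le> pmf (map_pmf h r) y"
  using assms
  by (auto simp: pmf_map measure_measure_pmf_finite [symmetric] intro!: measure_pmf.finite_measure_mono)

text \<open>Conditional form of Gibbs' inequality. In the sum of ratios the mass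
  \<open>pmf ?E d\<close> cancels. What remains is \<open>m\<close> times the sum, over the observed
  \<open>y\<close>, of the empirical mass of \<open>y\<close> times the conditional mass under
  \<open>r\<close> of the observed points above \<open>y\<close>, and the latter is at most
  1.\<close>

lemma prod_cond_pmf_le_empirical:
  fixes s :: "nat \<Rightarrow> 'a \<times> 'b"
  assumes m: "m \<ge> 1"
  shows "(\<Prod>k=1..m. pmf r (s k) / pmf (map_pmf snd r) (snd (s k))) \<le>
    (\<Prod>k=1..m. pmf (empirical m s) (s k) / pmf (map_pmf snd (empirical m s)) (snd (s k)))"
proof (rule prod_le_of_sum_ratio_le)
  let ?E = "empirical m s"
  define D where "D = s ` {1..m}"
  define p where "p = pmf (map_pmf snd ?E)"
  define w where "w = pmf (map_pmf snd r)"
  have p_pos: "p (snd (s k)) > 0" if "k \<in> {1..m}" for k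
    using pmf_empirical_pos[OF that, of "\<lambda>k. snd (s k)"] by (simp add: p_def map_pmf_empirical)
  have "(\<Sum>k=1..m. (pmf r (s k) / w (snd (s k))) / (pmf ?E (s k) / p (snd (s k)))) =
      m * (\<Sum>d\<in>D. pmf ?E d * ((pmf r d / w (snd d)) / (pmf ?E d / p (snd d))))"
    using m by (intro sum_eq_empirical) (auto simp: D_def)
  also have "(\<Sum>d\<in>D. pmf ?E d * ((pmf r d / w (snd d)) / (pmf ?E d / p (snd d)))) =
      (\<Sum>d\<in>D. pmf r d / w (snd d) * p (snd d))"
  proof (intro sum.cong refl)
    fix d assume "d \<in> D"
    then have "pmf ?E d > 0" using pmf_empirical_pos[of _ m s] by (auto simp: D_def)
    then show "pmf ?E d * ((pmf r d / w (snd d)) / (pmf ?E d / p (snd d))) =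
      pmf r d / w (snd d) * p (snd d)" by simp
  qed
  also have "\<dots> = (\<Sum>y\<in>snd ` D. \<Sum>d\<in>{d\<in>D. snd d = y}. pmf r d / w (snd d) * p (snd d))"
    by (rule sum.image_gen) (simp add: D_def)
  also have "\<dots> = (\<Sum>y\<in>snd ` D. (\<Sum>d\<in>{d\<in>D. snd d = y}. pmf r d) / w y * p y)"
    by (simp add: sum_divide_distrib sum_distrib_right)
  also have "\<dots> \<le> (\<Sum>y\<in>snd ` D. p y)"
  proof (rule sum_mono)
    fix y
    have "(\<Sum>d\<in>{d\<in>D. snd d = y}. pmf r d) \<le> w y"
      unfolding w_def by (rule sum_pmf_fibre_le) (auto simp: D_def)
    \<comment> \<open>If \<open>w y = 0\<close>, the quotient is 0 by the convention for division by
      zero.\<close>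
    then have "(\<Sum>d\<in>{d\<in>D. snd d = y}. pmf r d) / w y \<le> 1"
      using pmf_nonneg[of "map_pmf snd r" y] by (cases "w y = 0") (auto simp: w_def divide_le_eq_1)
    then have "(\<Sum>d\<in>{d\<in>D. snd d = y}. pmf r d) / w y * p y \<le> 1 * p y"
      by (rule mult_right_mono) (simp add: p_def)
    then show "(\<Sum>d\<in>{d\<in>D. snd d = y}. pmf r d) / w y * p y \<le> p y" by simp
  qed
  also have "\<dots> \<le> 1"
    unfolding p_def using m
    by (subst sum_pmf_eq_1) (auto simp: D_def set_pmf_empirical)
  finally show "(\<Sum>k=1..m. (pmf r (s k) / pmf (map_pmf snd r) (snd (s k))) /
      (pmf ?E (s k) / pmf (map_pmf snd ?E) (snd (s k)))) \<le> card {1..m}"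
    using m by (simp add: w_def p_def)
  fix k assume k: "k \<in> {1..m}"
  show "0 < pmf ?E (s k) / pmf (map_pmf snd ?E) (snd (s k))"
    using p_pos[OF k] pmf_empirical_pos[OF k, of s] by (simp add: p_def)
qed auto

lemma prod_cond_map_pmf_le_empirical:
  assumes "m \<ge> 1"
  shows "(\<Prod>k=1..m. pmf (map_pmf (\<lambda>z. (g z, h z)) r) (g (s k), h (s k)) / pmf (map_pmf h r) (h (s k))) \<le>
    (\<Prod>k=1..m. pmf (map_pmf (\<lambda>z. (g z, h z)) (empirical m s)) (g (s k), h (s k)) /
       pmf (map_pmf h (empirical m s)) (h (s k)))"
  using prod_cond_pmf_le_empirical[OF assms, of "map_pmf (\<lambda>z. (g z, h z)) r" "\<lambda>k. (g (s k), h (s k))"]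
  by (simp add: map_pmf_comp map_pmf_empirical)

lemma prod_map_pmf_le_empirical:
  assumes "m \<ge> 1"
  shows "(\<Prod>k=1..m. pmf (map_pmf g r) (g (s k))) \<le>
    (\<Prod>k=1..m. pmf (map_pmf g (empirical m s)) (g (s k)))"
proof -
  \<comment> \<open>Conditioning on a constant gives the unconditional case.\<close>
  have "pmf (map_pmf (\<lambda>z. (g z, ())) q) (a, ()) = pmf (map_pmf g q) a" for q a
    by (auto simp: pmf_map intro!: arg_cong[where f = "measure _"])
  then show ?thesis
    using prod_cond_map_pmf_le_empirical[OF assms, of g "\<lambda>_. ()" r s] by simp
qed

section \<open>Members of the two classes built from conditional laws\<close>

lemma pmf_bind_map_Pair:
  "pmf (bind_pmf p (\<lambda>y. map_pmf (\<lambda>x. (x, y)) (K y))) (x, y) = pmf p y * pmf (K y) x"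
  "pmf (bind_pmf p (\<lambda>y. map_pmf (Pair y) (K y))) (y, x) = pmf p y * pmf (K y) x"
proof -
  have fibre: "pmf (map_pmf (\<lambda>x. (x, y')) (K y')) (x, y) = (if y = y' then pmf (K y') x else 0)"
    "pmf (map_pmf (Pair y') (K y')) (y, x) = (if y = y' then pmf (K y') x else 0)" for y'
    by (auto simp: pmf_map vimage_def measure_pmf_single)
  \<comment> \<open>With \<open>K y\<close> in place of \<open>K y'\<close>, this factor is constant
    in the integral over \<open>y'\<close>.\<close>
  have 1: "(if y = y' then pmf (K y') x else 0) = indicator {y} y' * pmf (K y) x" for y'
    by simp
  show "pmf (bind_pmf p (\<lambda>y. map_pmf (\<lambda>x. (x, y)) (K y))) (x, y) = pmf p y * pmf (K y) x"
    "pmf (bind_pmf p (\<lambda>y. map_pmf (Pair y) (K y))) (y, x) = pmf p y * pmf (K y) x"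
    unfolding pmf_bind fibre 1 by (simp_all add: measure_pmf_single)
qed

lemma prob_eq_pmf_map: "\<P>(z in measure_pmf q. g z = a) = pmf (map_pmf g q) a"
  by (simp add: pmf_map vimage_def)

lemma cond_prob_eq_pmf_map:
  "\<P>(z in measure_pmf q. g z = a \<bar> h z = y) =
    pmf (map_pmf (\<lambda>z. (g z, h z)) q) (a, y) / pmf (map_pmf h q) y"
  by (simp add: cond_prob_def pmf_map vimage_def)

text \<open>For \<open>y\<close> outside the support the right side would be 0, whereas
  \<open>cond_pmf\<close> on a null event is unspecified.\<close>

lemma pmf_map_cond_pmf:
  assumes "y \<in> set_pmf (map_pmf h q)"
  shows "pmf (map_pmf g (cond_pmf q {z. h z = y})) a =
    pmf (map_pmf (\<lambda>z. (g z, h z)) q) (a, y) / pmf (map_pmf h q) y"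
proof -
  have ne: "set_pmf q \<inter> {z. h z = y} \<noteq> {}" using assms by auto
  have "measure (measure_pmf (cond_pmf q {z. h z = y})) (g -` {a}) =
    measure (measure_pmf q) ({z. h z = y} \<inter> g -` {a}) / measure (measure_pmf q) {z. h z = y}"
    unfolding cond_pmf.rep_eq[OF ne]
    by (rule measure_uniform_measure) (use emeasure_measure_pmf_not_zero[OF ne] in auto)
  moreover have "{z. h z = y} \<inter> g -` {a} = (\<lambda>z. (g z, h z)) -` {(a, y)}" "{z. h z = y} = h -` {y}"
    by auto
  ultimately show ?thesis by (simp add: pmf_map)
qed

text \<open>Draw \<open>y\<close> first, then independent coordinates with laws
  \<open>\<kappa> y j\<close>. The default \<open>undefined\<close> makes each drawn
  \<open>x\<close> extensional, as \<open>joint_alphabet\<close> demands. \<open>\<kappa>\<close> is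
  constrained on the support of \<open>p\<close> because it will be a conditional law given
  \<open>y\<close>.\<close>

lemma bind_Pi_pmf_in_class_T:
  assumes p: "set_pmf p \<subseteq> B"
    and \<kappa>: "\<And>y j. y \<in> set_pmf p \<Longrightarrow> j \<in> {1..n} \<Longrightarrow> set_pmf (\<kappa> y j) \<subseteq> A j"
  shows "bind_pmf p (\<lambda>y. map_pmf (\<lambda>x. (x, y)) (Pi_pmf {1..n} undefined (\<kappa> y))) \<in> class_T n A B"
    (is "?r \<in> _")
  unfolding class_T_def mem_Collect_eq
proof (intro conjI ballI, safe)
  fix x y assume "(x, y) \<in> set_pmf ?r"
  then have "y \<in> set_pmf p" "x \<in> PiE_dflt {1..n} undefined (set_pmf \<circ> \<kappa> y)"
    by (auto simp: set_Pi_pmf)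
  then show "(x, y) \<in> joint_alphabet n A B"
    using p \<kappa> by (force simp: joint_alphabet_def PiE_dflt_def)
next
  fix x y assume xy: "(x, y) \<in> joint_alphabet n A B"
  have snd_r: "map_pmf snd ?r = p"
    by (simp add: map_bind_pmf map_pmf_comp bind_return_pmf')
  \<comment> \<open>The quotient stays uncancelled, so the equation also covers null
    \<open>y\<close>, where both sides are 0; the leading \<open>pmf p y\<close> then annihilates
    the whole factorization.\<close>
  have cond: "\<P>(z in measure_pmf ?r. fst z j = x j \<bar> snd z = y) = pmf p y * pmf (\<kappa> y j) (x j) / pmf p y"
    if "j \<in> {1..n}" for j
  proof -
    have "map_pmf (\<lambda>z. (fst z j, snd z)) ?r =
        bind_pmf p (\<lambda>y. map_pmf (\<lambda>a. (a, y)) (map_pmf (\<lambda>x. x j) (Pi_pmf {1..n} undefined (\<kappa> y))))"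
      by (simp add: map_bind_pmf map_pmf_comp)
    also have "\<dots> = bind_pmf p (\<lambda>y. map_pmf (\<lambda>a. (a, y)) (\<kappa> y j))"
      using that by (subst Pi_pmf_component) auto
    finally show ?thesis by (simp only: cond_prob_eq_pmf_map snd_r pmf_bind_map_Pair(1))
  qed
  have "pmf ?r (x, y) = pmf p y * (\<Prod>j=1..n. pmf (\<kappa> y j) (x j))"
    using xy by (subst pmf_bind_map_Pair(1), subst pmf_Pi') (auto simp: joint_alphabet_def PiE_iff extensional_def)
  also have "\<dots> = pmf p y * (\<Prod>j=1..n. pmf p y * pmf (\<kappa> y j) (x j) / pmf p y)"
    by (cases "pmf p y = 0") auto
  finally show "pmf ?r (x, y) = \<P>(z in measure_pmf ?r. snd z = y) *
      (\<Prod>j=1..n. \<P>(z in measure_pmf ?r. fst z j = x j \<bar> snd z = y))"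
    using cond by (simp only: prob_eq_pmf_map snd_r cong: prod.cong)
qed

text \<open>Draw independent coordinates first, then \<open>y\<close> from the kernel
  \<open>K x\<close>; the marginal of \<open>x\<close> is then the product law itself.\<close>

lemma bind_Pi_pmf_in_class_H:
  assumes \<xi>: "\<And>j. j \<in> {1..n} \<Longrightarrow> set_pmf (\<xi> j) \<subseteq> A j" and K: "\<And>x. set_pmf (K x) \<subseteq> B"
  shows "bind_pmf (Pi_pmf {1..n} undefined \<xi>) (\<lambda>x. map_pmf (Pair x) (K x)) \<in> class_H n A B"
    (is "?r \<in> _")
  unfolding class_H_def mem_Collect_eq
proof (intro conjI ballI, safe)
  fix x y assume "(x, y) \<in> set_pmf ?r"
  then have "y \<in> set_pmf (K x)" "x \<in> PiE_dflt {1..n} undefined (set_pmf \<circ> \<xi>)"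
    by (auto simp: set_Pi_pmf)
  then show "(x, y) \<in> joint_alphabet n A B"
    using \<xi> K by (force simp: joint_alphabet_def PiE_dflt_def)
next
  fix x y assume xy: "(x, y) \<in> joint_alphabet n A B"
  define P where "P = Pi_pmf {1..n} undefined \<xi>"
  have fst_r: "map_pmf fst ?r = P"
    by (simp add: map_bind_pmf map_pmf_comp bind_return_pmf' P_def)
  have comp: "map_pmf (\<lambda>z. fst z j) ?r = \<xi> j" if "j \<in> {1..n}" for j
  proof -
    have "map_pmf (\<lambda>z. fst z j) ?r = map_pmf (\<lambda>x. x j) (map_pmf fst ?r)"
      by (simp only: map_pmf_comp)
    then show ?thesis using that by (simp only: fst_r) (simp add: P_def Pi_pmf_component)
  qed
  \<comment> \<open>The components are swapped because \<open>cond_prob_eq_pmf_map\<close> puts the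
    outcome first and the condition second.\<close>
  have "map_pmf (\<lambda>z. (snd z, fst z)) ?r = bind_pmf P (\<lambda>x. map_pmf (\<lambda>y. (y, x)) (K x))"
    by (simp add: map_bind_pmf map_pmf_comp P_def)
  then have cond: "\<P>(z in measure_pmf ?r. snd z = y \<bar> fst z = x) = pmf P x * pmf (K x) y / pmf P x"
    by (simp only: cond_prob_eq_pmf_map fst_r pmf_bind_map_Pair(1))
  have Px: "pmf P x = (\<Prod>j=1..n. pmf (\<xi> j) (x j))"
    using xy unfolding P_def by (subst pmf_Pi') (auto simp: joint_alphabet_def PiE_iff extensional_def)
  have "pmf ?r (x, y) = pmf P x * pmf (K x) y / pmf P x * pmf P x"
    by (simp add: P_def pmf_bind_map_Pair(2))
  also have "\<dots> = \<P>(z in measure_pmf ?r. snd z = y \<bar> fst z = x) *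
      (\<Prod>j=1..n. \<P>(z in measure_pmf ?r. fst z j = x j))"
    unfolding cond Px prob_eq_pmf_map using comp by (simp only: cong: prod.cong)
  finally show "pmf ?r (x, y) = \<P>(z in measure_pmf ?r. snd z = y \<bar> fst z = x) *
      (\<Prod>j=1..n. \<P>(z in measure_pmf ?r. fst z j = x j))" .
qed

lemma prod_times_prod:
  fixes f :: "'k \<Rightarrow> 'c::comm_monoid_mult"
  shows "(\<Prod>k\<in>K. f k * (\<Prod>j\<in>J. g j k)) = prod f K * (\<Prod>j\<in>J. \<Prod>k\<in>K. g j k)"
  by (simp only: prod.distrib prod.swap[of _ J])

section \<open>Suprema of the likelihood over the two classes\<close>

text \<open>For \<open>r\<close> in the class the likelihood equals \<open>?L r\<close>, each factor
  of which is at most its counterpart at \<open>E\<close>. The bound \<open>?L E\<close> is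
  attained, so the supremum is a maximum.\<close>

lemma Sup_likelihood_class_T:
  fixes s :: "nat \<Rightarrow> (nat \<Rightarrow> 'a) \<times> 'b"
  assumes m: "m \<ge> 1" and s: "s ` {1..m} \<subseteq> joint_alphabet n A B"
  defines "E \<equiv> empirical m s"
  shows "(SUP r\<in>class_T n A B. likelihood m s r) =
    (\<Prod>k=1..m. pmf (map_pmf snd E) (snd (s k))) *
    (\<Prod>j=1..n. \<Prod>k=1..m. pmf (map_pmf (\<lambda>z. (fst z j, snd z)) E) (fst (s k) j, snd (s k)) /
       pmf (map_pmf snd E) (snd (s k)))" (is "_ = ?L E")
proof (rule cSup_eq_maximum)
  fix l assume "l \<in> likelihood m s ` class_T n A B"
  then obtain r where r: "r \<in> class_T n A B" "l = likelihood m s r" by auto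
  have "pmf r (s k) = pmf (map_pmf snd r) (snd (s k)) *
      (\<Prod>j=1..n. pmf (map_pmf (\<lambda>z. (fst z j, snd z)) r) (fst (s k) j, snd (s k)) /
         pmf (map_pmf snd r) (snd (s k)))" if "k \<in> {1..m}" for k
  proof -
    have "(fst (s k), snd (s k)) \<in> joint_alphabet n A B" using s that by auto
    then show ?thesis
      using r(1) unfolding class_T_def mem_Collect_eq prob_eq_pmf_map cond_prob_eq_pmf_map
      by (cases "s k") auto
  qed
  then have "l = ?L r"
    unfolding r(2) likelihood_def prod_times_prod [symmetric] by (intro prod.cong refl)
  also have "\<dots> \<le> ?L E"
    unfolding E_def using m
    by (intro mult_mono prod_map_pmf_le_empirical prod_mono conjI prod_cond_map_pmf_le_empirical prod_nonneg) auto
  finally show "l \<le> ?L E" .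
next
  \<comment> \<open>\<open>E\<close> itself need not lie in the class. The maximiser keeps its
    marginal of \<open>Y\<close> and its conditional laws of the single coordinates, but makes the
    coordinates independent given \<open>Y\<close>.\<close>
  define r where "r = bind_pmf (map_pmf snd E) (\<lambda>y. map_pmf (\<lambda>x. (x, y))
    (Pi_pmf {1..n} undefined (\<lambda>j. map_pmf (\<lambda>z. fst z j) (cond_pmf E {z. snd z = y}))))"
  have set_E: "set_pmf E = s ` {1..m}" unfolding E_def using m by (rule set_pmf_empirical)
  have "r \<in> class_T n A B" unfolding r_def
  proof (intro bind_Pi_pmf_in_class_T)
    show "set_pmf (map_pmf snd E) \<subseteq> B" using s by (auto simp: set_E joint_alphabet_def)
    fix y j assume "y \<in> set_pmf (map_pmf snd E)" and j: "j \<in> {1..n}"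
    then have ne: "set_pmf E \<inter> {z. snd z = y} \<noteq> {}" by auto
    show "set_pmf (map_pmf (\<lambda>z. fst z j) (cond_pmf E {z. snd z = y})) \<subseteq> A j"
      using s j by (force simp: set_cond_pmf[OF ne] set_E joint_alphabet_def)
  qed
  moreover have "pmf r (s k) = pmf (map_pmf snd E) (snd (s k)) *
      (\<Prod>j=1..n. pmf (map_pmf (\<lambda>z. (fst z j, snd z)) E) (fst (s k) j, snd (s k)) /
         pmf (map_pmf snd E) (snd (s k)))" if k: "k \<in> {1..m}" for k
  proof -
    obtain x y where sk: "s k = (x, y)" by (cases "s k")
    have "(x, y) \<in> joint_alphabet n A B" using s k sk by force
    \<comment> \<open>Off the index set a sample point must agree with the default of
      \<open>Pi_pmf\<close>; otherwise its mass under \<open>r\<close> would be 0.\<close>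
    then have ext: "x j = undefined" if "j \<notin> {1..n}" for j
      using that by (auto simp: joint_alphabet_def PiE_iff extensional_def)
    have "s k \<in> set_pmf E" using k by (simp add: set_E)
    then have "y \<in> set_pmf (map_pmf snd E)" by (force simp: sk)
    then show ?thesis
      using ext unfolding sk r_def pmf_bind_map_Pair(1)
      by (subst pmf_Pi') (auto simp: pmf_map_cond_pmf)
  qed
  then have "likelihood m s r = ?L E"
    unfolding likelihood_def prod_times_prod [symmetric] by (intro prod.cong refl)
  ultimately show "?L E \<in> likelihood m s ` class_T n A B" by (metis image_eqI)
qed

lemma Sup_likelihood_class_H:
  fixes s :: "nat \<Rightarrow> (nat \<Rightarrow> 'a) \<times> 'b"
  assumes m: "m \<ge> 1" and s: "s ` {1..m} \<subseteq> joint_alphabet n A B"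
  defines "E \<equiv> empirical m s"
  shows "(SUP r\<in>class_H n A B. likelihood m s r) =
    (\<Prod>k=1..m. pmf (map_pmf (\<lambda>z. (snd z, fst z)) E) (snd (s k), fst (s k)) /
       pmf (map_pmf fst E) (fst (s k))) *
    (\<Prod>j=1..n. \<Prod>k=1..m. pmf (map_pmf (\<lambda>z. fst z j) E) (fst (s k) j))" (is "_ = ?L E")
proof (rule cSup_eq_maximum)
  fix l assume "l \<in> likelihood m s ` class_H n A B"
  then obtain r where r: "r \<in> class_H n A B" "l = likelihood m s r" by auto
  have "pmf r (s k) = pmf (map_pmf (\<lambda>z. (snd z, fst z)) r) (snd (s k), fst (s k)) /
       pmf (map_pmf fst r) (fst (s k)) *
      (\<Prod>j=1..n. pmf (map_pmf (\<lambda>z. fst z j) r) (fst (s k) j))" if "k \<in> {1..m}" for k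
  proof -
    have "(fst (s k), snd (s k)) \<in> joint_alphabet n A B" using s that by auto
    then show ?thesis
      using r(1) unfolding class_H_def mem_Collect_eq prob_eq_pmf_map cond_prob_eq_pmf_map
      by (cases "s k") auto
  qed
  then have "l = ?L r"
    unfolding r(2) likelihood_def prod_times_prod [symmetric] by (intro prod.cong refl)
  also have "\<dots> \<le> ?L E"
    unfolding E_def using m
    by (intro mult_mono prod_map_pmf_le_empirical prod_mono conjI prod_cond_map_pmf_le_empirical prod_nonneg) auto
  finally show "l \<le> ?L E" .
next
  \<comment> \<open>The product of the empirical marginals also charges points \<open>x\<close> outside the sample, where
    \<open>cond_pmf\<close> is unspecified; any conditional law supported in \<open>B\<close> will do there.\<close>
  define K where "K x = (if x \<in> set_pmf (map_pmf fst E)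
    then map_pmf snd (cond_pmf E {z. fst z = x}) else map_pmf snd E)" for x
  define r where "r = bind_pmf (Pi_pmf {1..n} undefined (\<lambda>j. map_pmf (\<lambda>z. fst z j) E))
    (\<lambda>x. map_pmf (Pair x) (K x))"
  have set_E: "set_pmf E = s ` {1..m}" unfolding E_def using m by (rule set_pmf_empirical)
  have "r \<in> class_H n A B" unfolding r_def
  proof (intro bind_Pi_pmf_in_class_H)
    fix j assume j: "j \<in> {1..n}"
    show "set_pmf (map_pmf (\<lambda>z. fst z j) E) \<subseteq> A j"
      using s j by (force simp: set_E joint_alphabet_def)
  next
    fix x
    have "set_pmf (K x) \<subseteq> snd ` set_pmf E"
    proof (cases "x \<in> set_pmf (map_pmf fst E)")
      case True
      then have ne: "set_pmf E \<inter> {z. fst z = x} \<noteq> {}" by auto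
      show ?thesis using True by (auto simp: K_def set_cond_pmf[OF ne])
    qed (simp add: K_def)
    also have "\<dots> \<subseteq> B" using s by (auto simp: set_E joint_alphabet_def)
    finally show "set_pmf (K x) \<subseteq> B" .
  qed
  moreover have "pmf r (s k) = pmf (map_pmf (\<lambda>z. (snd z, fst z)) E) (snd (s k), fst (s k)) /
       pmf (map_pmf fst E) (fst (s k)) *
      (\<Prod>j=1..n. pmf (map_pmf (\<lambda>z. fst z j) E) (fst (s k) j))" if k: "k \<in> {1..m}" for k
  proof -
    obtain x y where sk: "s k = (x, y)" by (cases "s k")
    have "(x, y) \<in> joint_alphabet n A B" using s k sk by force
    then have ext: "x j = undefined" if "j \<notin> {1..n}" for j
      using that by (auto simp: joint_alphabet_def PiE_iff extensional_def)
    have "s k \<in> set_pmf E" using k by (simp add: set_E)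
    then have x: "x \<in> set_pmf (map_pmf fst E)" by (force simp: sk)
    then have "pmf (K x) y = pmf (map_pmf (\<lambda>z. (snd z, fst z)) E) (y, x) / pmf (map_pmf fst E) x"
      unfolding K_def by (simp only: if_True pmf_map_cond_pmf[OF x])
    then show ?thesis
      using ext unfolding sk r_def pmf_bind_map_Pair(2)
      by (subst pmf_Pi') auto
  qed
  then have "likelihood m s r = ?L E"
    unfolding likelihood_def prod_times_prod [symmetric] by (intro prod.cong refl)
  ultimately show "?L E \<in> likelihood m s ` class_H n A B" by (metis image_eqI)
qed

section \<open>Entropies as functions of point masses\<close>

text \<open>Taken for an arbitrary real function on the points, so that it applies to empirical
  frequencies and to probabilities in \<open>M\<close> alike and admits pointwise limits.\<close>

definition marginal :: "'c set \<Rightarrow> ('c \<Rightarrow> 'd) \<Rightarrow> ('c \<Rightarrow> real) \<Rightarrow> 'd \<Rightarrow> real" where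
  "marginal D h q c = (\<Sum>d\<in>{d\<in>D. h d = c}. q d)"

definition marginal_entropy :: "real \<Rightarrow> 'c set \<Rightarrow> ('c \<Rightarrow> 'd) \<Rightarrow> ('c \<Rightarrow> real) \<Rightarrow> real" where
  "marginal_entropy b D h q = - (\<Sum>c\<in>h ` D. marginal D h q c * log b (marginal D h q c))"

text \<open>Each mutual information is expanded as H(U) + H(V) - H(U,V).\<close>

definition mass_rsi ::
  "real \<Rightarrow> nat \<Rightarrow> ((nat \<Rightarrow> 'a) \<times> 'b) set \<Rightarrow> ((nat \<Rightarrow> 'a) \<times> 'b \<Rightarrow> real) \<Rightarrow> real" where
  "mass_rsi b n D q =
    (\<Sum>j=1..n. marginal_entropy b D (\<lambda>z. fst z j) q + marginal_entropy b D snd q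
      - marginal_entropy b D (\<lambda>z. (fst z j, snd z)) q)
    - (marginal_entropy b D fst q + marginal_entropy b D snd q
      - marginal_entropy b D (\<lambda>z. (snd z, fst z)) q)"

text \<open>Relabelling the values only reindexes the sum. This serves to swap the components of a
  pair.\<close>

lemma marginal_entropy_inj:
  assumes "inj f"
  shows "marginal_entropy b D (\<lambda>z. f (h z)) q = marginal_entropy b D h q"
proof -
  have "marginal D (\<lambda>z. f (h z)) q (f c) = marginal D h q c" for c
    using assms by (simp add: marginal_def inj_eq)
  moreover have "inj_on f (h ` D)" using assms by (rule inj_on_subset) simp
  ultimately show ?thesis
    by (simp add: marginal_entropy_def image_image [of f h, symmetric] sum.reindex)
qed

lemma pmf_map_eq_marginal:
  assumes "finite D" "set_pmf q \<subseteq> D"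
  shows "pmf (map_pmf h q) c = marginal D h (pmf q) c"
proof -
  have "pmf (map_pmf h q) c = measure (measure_pmf q) {d\<in>D. h d = c}"
    unfolding pmf_map using assms(2)
    by (intro measure_pmf.finite_measure_eq_AE) (auto simp: AE_measure_pmf_iff)
  then show ?thesis using assms(1) by (simp add: marginal_def measure_measure_pmf_finite)
qed

text \<open>Grouped by the value of \<open>h\<close>, the sum of logarithms is, up to sign,
  \<open>m\<close> times the cross-entropy of the empirical marginal with itself.\<close>

lemma log_prod_empirical:
  assumes m: "m \<ge> 1" and D: "finite D" "s ` {1..m} \<subseteq> D"
  shows "log b (\<Prod>k=1..m. pmf (map_pmf h (empirical m s)) (h (s k))) =
    - (m * marginal_entropy b D h (pmf (empirical m s)))"
proof -
  let ?p = "pmf (map_pmf h (empirical m s))"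
  have pos: "?p (h (s k)) > 0" if "k \<in> {1..m}" for k
    using pmf_empirical_pos[OF that, of "\<lambda>k. h (s k)"] by (simp add: map_pmf_empirical)
  have "log b (\<Prod>k=1..m. ?p (h (s k))) = (\<Sum>k=1..m. log b (?p (h (s k))))"
    unfolding log_def sum_divide_distrib [symmetric]
    by (subst ln_prod) (auto simp: less_imp_neq[OF pos, symmetric])
  also have "\<dots> = m * (\<Sum>c\<in>h ` D. ?p c * log b (?p c))"
    using sum_eq_empirical[of m "h ` D" "\<lambda>k. h (s k)" "\<lambda>c. log b (?p c)"] m D
    by (auto simp: map_pmf_empirical)
  also have "\<dots> = - (m * marginal_entropy b D h (pmf (empirical m s)))"
    using m D by (simp add: marginal_entropy_def pmf_map_eq_marginal set_pmf_empirical)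
  finally show ?thesis .
qed

lemma prod_empirical_pos:
  "(\<Prod>k=1..m. pmf (map_pmf h (empirical m s)) (h (s k))) > 0"
  using pmf_empirical_pos[of _ m "\<lambda>k. h (s k)"] by (intro prod_pos) (auto simp: map_pmf_empirical)

text \<open>With entropies of the empirical law, the class T maximum contributes -H(Y) - sum_j
  (H(X_j,Y) - H(Y)) per sample, and the class H maximum -(H(Y,X) - H(X)) - sum_j H(X_j). Their
  difference regroups into mutual informations.\<close>

lemma gen_log_likelihood_ratio_T_H:
  fixes s :: "nat \<Rightarrow> (nat \<Rightarrow> 'a) \<times> 'b"
  assumes m: "m \<ge> 1" and D: "finite (joint_alphabet n A B)" "s ` {1..m} \<subseteq> joint_alphabet n A B"
  shows "1 / real m * gen_log_likelihood_ratio b (class_T n A B) (class_H n A B) m s =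
    mass_rsi b n (joint_alphabet n A B) (pmf (empirical m s))"
proof -
  define E where "E = empirical m s"
  let ?H = "\<lambda>h. marginal_entropy b (joint_alphabet n A B) h (pmf E)"
  note pos = prod_empirical_pos[of _ m s, folded E_def]
  note logs = log_prod_empirical[OF m D, of b, folded E_def]
  define lY where "lY = (\<Prod>k=1..m. pmf (map_pmf snd E) (snd (s k)))"
  define lX where "lX = (\<Prod>k=1..m. pmf (map_pmf fst E) (fst (s k)))"
  define lYX where "lYX = (\<Prod>k=1..m. pmf (map_pmf (\<lambda>z. (snd z, fst z)) E) (snd (s k), fst (s k)))"
  define lj where "lj j = (\<Prod>k=1..m. pmf (map_pmf (\<lambda>z. fst z j) E) (fst (s k) j))" for j
  define ljY where "ljY j =
    (\<Prod>k=1..m. pmf (map_pmf (\<lambda>z. (fst z j, snd z)) E) (fst (s k) j, snd (s k)))" for j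
  have pos: "lY > 0" "lX > 0" "lYX > 0" "lj j > 0" "ljY j > 0" for j
    unfolding lY_def lX_def lYX_def lj_def ljY_def by (rule pos)+
  have logs: "log b lY = - (m * ?H snd)" "log b lX = - (m * ?H fst)"
    "log b lYX = - (m * ?H (\<lambda>z. (snd z, fst z)))" "log b (lj j) = - (m * ?H (\<lambda>z. fst z j))"
    "log b (ljY j) = - (m * ?H (\<lambda>z. (fst z j, snd z)))" for j
    unfolding lY_def lX_def lYX_def lj_def ljY_def by (rule logs)+
  have log_prod: "log b (\<Prod>j=1..n. f j) = (\<Sum>j=1..n. log b (f j))" if "\<And>j. f j > 0" for f
    unfolding log_def sum_divide_distrib [symmetric]
    by (subst ln_prod) (auto simp: less_imp_neq[OF that, symmetric])
  have "gen_log_likelihood_ratio b (class_T n A B) (class_H n A B) m s =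
      log b ((lY * (\<Prod>j=1..n. ljY j / lY)) / (lYX / lX * (\<Prod>j=1..n. lj j)))"
    unfolding gen_log_likelihood_ratio_def Sup_likelihood_class_T[OF m D(2)]
      Sup_likelihood_class_H[OF m D(2)] E_def [symmetric] prod_dividef
      lY_def [symmetric] lX_def [symmetric] lYX_def [symmetric] lj_def [symmetric] ljY_def [symmetric] ..
  also have "\<dots> = log b lY + (\<Sum>j=1..n. log b (ljY j) - log b lY) -
      (log b lYX - log b lX + (\<Sum>j=1..n. log b (lj j)))"
  proof -
    define u v where "u = (\<Prod>j=1..n. ljY j / lY)" and "v = (\<Prod>j=1..n. lj j)"
    have uv: "u > 0" "v > 0" unfolding u_def v_def using pos by (auto intro!: prod_pos)
    have "log b u = (\<Sum>j=1..n. log b (ljY j) - log b lY)"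
      unfolding u_def using pos by (subst log_prod) (simp_all add: log_divide_pos)
    moreover have "log b v = (\<Sum>j=1..n. log b (lj j))"
      unfolding v_def using pos(4) by (rule log_prod)
    ultimately show ?thesis
      using pos uv unfolding u_def [symmetric] v_def [symmetric]
      by (simp only: log_mult_pos log_divide_pos mult_pos_pos divide_pos_pos)
  qed
  also have "\<dots> = m * mass_rsi b n (joint_alphabet n A B) (pmf E)"
    unfolding logs mass_rsi_def
    by (simp add: algebra_simps sum.distrib sum_subtractf sum_distrib_left sum_negf)
  finally show ?thesis using m by (simp add: E_def)
qed

section \<open>Continuity of the index in the point masses\<close>

text \<open>Away from 0 the function t log t is continuous; at 0 it is continuous from the right,
  which suffices since \<open>f\<close> is nonnegative.\<close>

lemma tendsto_times_log:
  assumes "(f \<longlongrightarrow> l) F" "\<And>x. f x \<ge> 0" "b > 1"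
  shows "((\<lambda>x. f x * log b (f x)) \<longlongrightarrow> l * log b l) F"
proof (cases "l = 0")
  case False
  then show ?thesis using assms unfolding log_def by (intro tendsto_intros) auto
next
  case True
  have "((\<lambda>x::real. x * ln x) \<longlongrightarrow> 0) (at_right 0)" by real_asymp
  \<comment> \<open>The value \<open>0 * ln 0\<close> is 0, so the one-sided limit is the value of
    the function at 0.\<close>
  then have "((\<lambda>x::real. x * ln x) \<longlongrightarrow> 0 * ln 0) (at 0 within {0..})"
    unfolding at_within_Ici_at_right by simp
  then have "continuous (at 0 within {0..}) (\<lambda>x::real. x * ln x)"
    by (simp add: continuous_within)
  then have "((\<lambda>x. f x * ln (f x)) \<longlongrightarrow> 0 * ln 0) F"
    using assms True by (intro continuous_within_tendsto_compose[of 0 "{0..}" "\<lambda>x. x * ln x"]) auto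
  then have "((\<lambda>x. f x * ln (f x) / ln b) \<longlongrightarrow> 0 / ln b) F"
    using assms by (intro tendsto_intros) auto
  then show ?thesis using True by (simp add: log_def)
qed

lemma tendsto_marginal_entropy:
  assumes "\<And>d. d \<in> D \<Longrightarrow> (\<lambda>i. q i d) \<longlonglongrightarrow> p d" "\<And>i d. q i d \<ge> 0" "b > 1"
  shows "(\<lambda>i. marginal_entropy b D h (q i)) \<longlonglongrightarrow> marginal_entropy b D h p"
  unfolding marginal_entropy_def marginal_def
  using assms by (intro tendsto_minus tendsto_sum tendsto_times_log sum_nonneg) auto

lemma tendsto_mass_rsi:
  assumes "\<And>d. d \<in> D \<Longrightarrow> (\<lambda>i. q i d) \<longlonglongrightarrow> p d" "\<And>i d. q i d \<ge> 0" "b > 1"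
  shows "(\<lambda>i. mass_rsi b n D (q i)) \<longlonglongrightarrow> mass_rsi b n D p"
  unfolding mass_rsi_def
  by (intro tendsto_add tendsto_diff tendsto_sum tendsto_marginal_entropy assms)

text \<open>Sequential continuity turned into a \<delta>, by contradiction: if every
  \<open>1 / Suc i\<close> failed, the counterexamples would converge pointwise to \<open>p\<close>.
  A single \<delta> is wanted because it has to serve all samples at once.\<close>

lemma mass_rsi_modulus:
  assumes "b > 1" "\<epsilon> > 0"
  obtains \<delta> where "\<delta> > 0"
    "\<And>q. (\<And>d. q d \<ge> 0) \<Longrightarrow> (\<And>d. d \<in> D \<Longrightarrow> \<bar>q d - p d\<bar> < \<delta>) \<Longrightarrow>
      \<bar>mass_rsi b n D q - mass_rsi b n D p\<bar> < \<epsilon>"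
proof (rule ccontr)
  assume contra: "\<not> thesis"
  have "\<exists>q. (\<forall>d. q d \<ge> 0) \<and> (\<forall>d\<in>D. \<bar>q d - p d\<bar> < 1 / Suc i) \<and>
      \<not> \<bar>mass_rsi b n D q - mass_rsi b n D p\<bar> < \<epsilon>" for i
  proof (rule ccontr)
    assume "\<not> ?thesis"
    then have thesis by (intro that[of "1 / Suc i"]) (simp, blast)
    then show False using contra by contradiction
  qed
  then obtain q where q: "\<And>i d. q i d \<ge> 0" "\<And>i d. d \<in> D \<Longrightarrow> \<bar>q i d - p d\<bar> < 1 / Suc i"
    "\<And>i. \<not> \<bar>mass_rsi b n D (q i) - mass_rsi b n D p\<bar> < \<epsilon>"
    by metis
  have "(\<lambda>i. q i d) \<longlonglongrightarrow> p d" if "d \<in> D" for d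
  proof (rule LIM_zero_cancel, rule Lim_null_comparison)
    show "\<forall>\<^sub>F i in sequentially. norm (q i d - p d) \<le> 1 / Suc i"
      unfolding real_norm_def using q(2)[OF that] by (intro always_eventually allI less_imp_le)
    show "(\<lambda>i. 1 / real (Suc i)) \<longlonglongrightarrow> 0" using LIMSEQ_inverse_real_of_nat by (simp add: inverse_eq_divide)
  qed
  then have "(\<lambda>i. mass_rsi b n D (q i)) \<longlonglongrightarrow> mass_rsi b n D p"
    using q(1) assms(1) by (rule tendsto_mass_rsi)
  from LIMSEQ_D[OF this assms(2)] q(3) show False by (metis order_refl real_norm_def)
qed

section \<open>The index of random variables in terms of their point masses\<close>

context information_space
begin

text \<open>I(U;V) = H(U) - H(U|V), and the chain rule starting from \<open>V\<close> replaces
  H(U|V); hence the order of the pair.\<close>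

lemma mutual_information_eq_entropies:
  assumes "simple_function M U" "simple_function M V"
  shows "\<I>(U ; V) = \<H>(U) + \<H>(V) - \<H>(\<lambda>\<omega>. (V \<omega>, U \<omega>))"
  using mutual_information_eq_entropy_conditional_entropy[OF assms] entropy_chain_rule[OF assms(2,1)]
  by simp

lemma simple_function_finite_valued:
  assumes "finite D" "Z \<in> measurable M (count_space D)"
  shows "simple_function M (\<lambda>\<omega>. h (Z \<omega>))"
proof -
  have "Z ` space M \<subseteq> D" using measurable_space[OF assms(2)] by auto
  moreover from this have "finite (Z ` space M)" using assms(1) by (rule finite_subset)
  ultimately have "simple_function M Z"
    using measurable_sets[OF assms(2)] by (auto simp: simple_function_def)
  then show ?thesis by (rule simple_function_compose1)
qed

text \<open>The event that \<open>h (Z \<omega>)\<close> equals \<open>c\<close> is the disjoint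
  union of the events that \<open>Z \<omega>\<close> equals \<open>d\<close>, over the
  \<open>d\<close> with \<open>h d = c\<close>.\<close>

lemma entropy_eq_marginal_entropy:
  assumes D: "finite D" and Z: "Z \<in> measurable M (count_space D)"
  shows "\<H>(\<lambda>\<omega>. h (Z \<omega>)) = marginal_entropy b D h (\<lambda>d. prob (Z -` {d} \<inter> space M))"
proof -
  define p where "p d = prob (Z -` {d} \<inter> space M)" for d
  define P where "P c = prob ((\<lambda>\<omega>. h (Z \<omega>)) -` {c} \<inter> space M)" for c
  have Z_in: "Z \<omega> \<in> D" if "\<omega> \<in> space M" for \<omega>
    using measurable_space[OF Z that] by simp
  have marg: "marginal D h p c = P c" for c
  proof -
    have "(\<Sum>d\<in>{d\<in>D. h d = c}. p d) = prob (\<Union>d\<in>{d\<in>D. h d = c}. Z -` {d} \<inter> space M)"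
      unfolding p_def using D Z
      by (intro finite_measure_finite_Union [symmetric]) (auto simp: disjoint_family_on_def)
    also have "(\<Union>d\<in>{d\<in>D. h d = c}. Z -` {d} \<inter> space M) = (\<lambda>\<omega>. h (Z \<omega>)) -` {c} \<inter> space M"
      using Z_in by auto
    finally show ?thesis by (simp add: marginal_def P_def)
  qed
  have "\<H>(\<lambda>\<omega>. h (Z \<omega>)) = - (\<Sum>c\<in>(\<lambda>\<omega>. h (Z \<omega>)) ` space M. P c * log b (P c))"
    using simple_function_finite_valued[OF D Z]
    by (intro entropy_simple_distributed simple_distributedI) (auto simp: P_def)
  also have "(\<Sum>c\<in>(\<lambda>\<omega>. h (Z \<omega>)) ` space M. P c * log b (P c)) = (\<Sum>c\<in>h ` D. P c * log b (P c))"
  proof (rule sum.mono_neutral_left)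
    show "\<forall>c\<in>h ` D - (\<lambda>\<omega>. h (Z \<omega>)) ` space M. P c * log b (P c) = 0"
    proof
      fix c assume "c \<in> h ` D - (\<lambda>\<omega>. h (Z \<omega>)) ` space M"
      then have "(\<lambda>\<omega>. h (Z \<omega>)) -` {c} \<inter> space M = {}" by (auto simp: image_iff)
      then show "P c * log b (P c) = 0" by (simp add: P_def)
    qed
  qed (use D Z_in in auto)
  finally show ?thesis unfolding marginal_entropy_def p_def [symmetric] marg .
qed

lemma rsi_eq_mass_rsi:
  assumes fin: "finite (joint_alphabet n A B)"
    and Z: "(\<lambda>\<omega>. (\<lambda>j\<in>{1..n}. X j \<omega>, Y \<omega>)) \<in> measurable M (count_space (joint_alphabet n A B))"
  shows "rsi n X Y = mass_rsi b n (joint_alphabet n A B)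
    (\<lambda>d. prob ((\<lambda>\<omega>. (\<lambda>j\<in>{1..n}. X j \<omega>, Y \<omega>)) -` {d} \<inter> space M))"
proof -
  define D where "D = joint_alphabet n A B"
  define p where "p d = prob ((\<lambda>\<omega>. (\<lambda>j\<in>{1..n}. X j \<omega>, Y \<omega>)) -` {d} \<inter> space M)" for d
  let ?H = "\<lambda>h. marginal_entropy b D h p"
  note ent = entropy_eq_marginal_entropy[OF fin Z, folded D_def p_def]
  note sf = simple_function_finite_valued[OF fin Z]
  have "\<I>(\<lambda>\<omega>. \<lambda>j\<in>{1..n}. X j \<omega> ; Y) = \<H>(\<lambda>\<omega>. \<lambda>j\<in>{1..n}. X j \<omega>) + \<H>(Y) -
      \<H>(\<lambda>\<omega>. (Y \<omega>, \<lambda>j\<in>{1..n}. X j \<omega>))"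
    using sf[of fst] sf[of snd] by (intro mutual_information_eq_entropies) simp_all
  moreover have "\<I>(X j ; Y) = \<H>(X j) + \<H>(Y) - \<H>(\<lambda>\<omega>. (Y \<omega>, X j \<omega>))" if "j \<in> {1..n}" for j
    using sf[of "\<lambda>z. fst z j"] sf[of snd] that by (intro mutual_information_eq_entropies) simp_all
  moreover have "\<H>(\<lambda>\<omega>. (Y \<omega>, X j \<omega>)) = ?H (\<lambda>z. (fst z j, snd z))" if "j \<in> {1..n}" for j
    using ent[of "\<lambda>z. (snd z, fst z j)"] that
      marginal_entropy_inj[OF inj_swap, of b D "\<lambda>z. (fst z j, snd z)" p] by simp
  moreover have "\<H>(X j) = ?H (\<lambda>z. fst z j)" if "j \<in> {1..n}" for j
    using ent[of "\<lambda>z. fst z j"] that by simp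
  ultimately show ?thesis
    using ent[of fst] ent[of snd] ent[of "\<lambda>z. (snd z, fst z)"]
    unfolding rsi_def mass_rsi_def D_def [symmetric] p_def [symmetric]
    by (intro arg_cong2[where f = minus] sum.cong refl) simp_all
qed

end

section \<open>Concentration of the empirical frequencies\<close>

lemma (in prob_space) frequency_Hoeffding:
  fixes m :: nat and \<delta> :: real and T :: "nat \<Rightarrow> 'a \<Rightarrow> 'c"
  assumes m: "m \<ge> 1" and indep: "indep_vars (\<lambda>_. count_space D) T {1..m}" and d: "d \<in> D"
    and p: "\<And>k. k \<in> {1..m} \<Longrightarrow> prob (T k -` {d} \<inter> space M) = p" and \<delta>: "\<delta> \<ge> 0"
  shows "prob {\<omega>\<in>space M. \<delta> \<le> \<bar>(\<Sum>k=1..m. indicator {d} (T k \<omega>)) / m - p\<bar>} \<le> 2 * exp (- 2 * m * \<delta>\<^sup>2)"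
proof -
  have rv: "random_variable (count_space D) (T k)" if "k \<in> {1..m}" for k
    using indep that unfolding indep_vars_def by blast
  have mean: "expectation (\<lambda>\<omega>. indicator {d} (T k \<omega>) :: real) = p" if k: "k \<in> {1..m}" for k
  proof -
    have "expectation (\<lambda>\<omega>. indicator {d} (T k \<omega>) :: real) =
        expectation (indicator (T k -` {d} \<inter> space M))"
      by (intro Bochner_Integration.integral_cong) (auto simp: indicator_def)
    also have "\<dots> = p"
      using rv[OF k] d p[OF k] by simp
    finally show ?thesis .
  qed
  interpret Hoeffding_ineq M "{1..m}" "\<lambda>k \<omega>. indicator {d} (T k \<omega>)" "\<lambda>_. 0" "\<lambda>_. 1" "m * p"
  proof unfold_locales
    show "indep_vars (\<lambda>_. borel) (\<lambda>k \<omega>. indicator {d} (T k \<omega>) :: real) {1..m}"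
      using indep by (rule indep_vars_compose2) auto
    have "m * p = (\<Sum>k=1..m. expectation (\<lambda>\<omega>. indicator {d} (T k \<omega>)))"
      using mean by simp
    then show "m * p \<equiv> (\<Sum>k=1..m. expectation (\<lambda>\<omega>. indicator {d} (T k \<omega>)))"
      by (rule eq_reflection)
  qed auto
  have "{\<omega>\<in>space M. \<delta> \<le> \<bar>(\<Sum>k=1..m. indicator {d} (T k \<omega>)) / m - p\<bar>} =
      {\<omega>\<in>space M. m * \<delta> \<le> \<bar>(\<Sum>k=1..m. indicator {d} (T k \<omega>)) - m * p\<bar>}"
  proof (intro Collect_cong conj_cong refl)
    fix \<omega>
    have "\<bar>(\<Sum>k=1..m. indicator {d} (T k \<omega>)) - m * p\<bar> =
        \<bar>m * ((\<Sum>k=1..m. indicator {d} (T k \<omega>)) / m - p)\<bar>"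
      using m by (simp add: right_diff_distrib)
    then show "(\<delta> \<le> \<bar>(\<Sum>k=1..m. indicator {d} (T k \<omega>)) / m - p\<bar>) =
        (m * \<delta> \<le> \<bar>(\<Sum>k=1..m. indicator {d} (T k \<omega>)) - m * p\<bar>)"
      using m by (simp only: abs_mult) simp
  qed
  \<comment> \<open>Each of the \<open>m\<close> indicators ranges over an interval of length 1, so
    the denominator is \<open>m\<close> and cancels one factor of \<open>m\<^sup>2\<close>.\<close>
  also have "prob \<dots> \<le> 2 * exp (- 2 * (m * \<delta>)\<^sup>2 / (\<Sum>k=1..m. (1 - 0)\<^sup>2))"
    using m \<delta> by (intro Hoeffding_ineq_abs_ge) auto
  also have "- 2 * (m * \<delta>)\<^sup>2 / (\<Sum>k=1..m. (1 - 0)\<^sup>2) = - 2 * m * \<delta>\<^sup>2"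
    using m by (simp add: power2_eq_square)
  finally show ?thesis .
qed

section \<open>Convergence in probability\<close>

theorem proposition2:
  fixes n :: nat and b :: real
    and A :: "nat \<Rightarrow> 'a set" and B :: "'b set"
    and M :: "'w measure" and X :: "nat \<Rightarrow> 'w \<Rightarrow> 'a" and Y :: "'w \<Rightarrow> 'b"
    and N :: "nat \<Rightarrow> 'v measure" and S :: "nat \<Rightarrow> nat \<Rightarrow> 'v \<Rightarrow> (nat \<Rightarrow> 'a) \<times> 'b"
  assumes "n \<ge> 2"
    and "\<And>j. j \<in> {1..n} \<Longrightarrow> finite (A j)" and "finite B"
    and "information_space M b"
    and "\<And>j. j \<in> {1..n} \<Longrightarrow> X j \<in> measurable M (count_space (A j))"
    and "Y \<in> measurable M (count_space B)"
    and "\<And>m. m \<ge> 1 \<Longrightarrow> prob_space (N m)"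
    and "\<And>m. m \<ge> 1 \<Longrightarrow>
      prob_space.indep_vars (N m) (\<lambda>_. count_space (joint_alphabet n A B)) (S m) {1..m}"
    and "\<And>m k. m \<ge> 1 \<Longrightarrow> k \<in> {1..m} \<Longrightarrow>
      distr (N m) (count_space (joint_alphabet n A B)) (S m k) =
      distr M (count_space (joint_alphabet n A B)) (\<lambda>\<omega>. (\<lambda>j\<in>{1..n}. X j \<omega>, Y \<omega>))"
  shows "tendsto_in_probability N
    (\<lambda>m \<omega>. 1 / real m *
       gen_log_likelihood_ratio b (class_T n A B) (class_H n A B) m (\<lambda>k. S m k \<omega>))
    (information_space.rsi M b n X Y)"
proof -
  interpret information_space M b by fact
  define D where "D = joint_alphabet n A B"
  define Z where "Z \<omega> = (\<lambda>j\<in>{1..n}. X j \<omega>, Y \<omega>)" for \<omega>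
  define p where "p d = prob (Z -` {d} \<inter> space M)" for d
  have fin: "finite D"
    unfolding D_def joint_alphabet_def using assms(2,3) by (intro finite_cartesian_product finite_PiE) auto
  have Z: "Z \<in> measurable M (count_space D)"
    unfolding measurable_count_space_eq2[OF fin]
  proof (intro conjI ballI)
    show "Z \<in> space M \<rightarrow> D"
      using measurable_space[OF assms(5)] measurable_space[OF assms(6)]
      by (auto simp: Z_def D_def joint_alphabet_def)
    fix d assume d: "d \<in> D"
    obtain x y where xy: "d = (x, y)" by (cases d)
    have x: "x \<in> (\<Pi>\<^sub>E j\<in>{1..n}. A j)" and y: "y \<in> B" using d by (auto simp: D_def xy joint_alphabet_def)
    \<comment> \<open>Both tuples are \<open>undefined\<close> off \<open>{1..n}\<close>, so
      equality need only be checked on the coordinates.\<close>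
    have "Z \<omega> = d \<longleftrightarrow> (\<forall>j\<in>{1..n}. X j \<omega> = x j) \<and> Y \<omega> = y" for \<omega>
      using x by (auto simp: Z_def xy fun_eq_iff PiE_iff extensional_def restrict_def)
    then have "Z -` {d} \<inter> space M = (\<Inter>j\<in>{1..n}. X j -` {x j} \<inter> space M) \<inter> (Y -` {y} \<inter> space M)"
      using assms(1) by auto
    also have "\<dots> \<in> sets M"
    \<comment> \<open>The finite intersection must have a nonempty index set, which
      \<open>n \<ge> 2\<close> provides.\<close>
    proof (rule sets.Int, rule sets.finite_INT)
      show "X j -` {x j} \<inter> space M \<in> sets M" if "j \<in> {1..n}" for j
        using measurable_sets[OF assms(5)[OF that], of "{x j}"] PiE_mem[OF x that] by simp
      show "Y -` {y} \<inter> space M \<in> sets M"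
        using measurable_sets[OF assms(6), of "{y}"] y by auto
    qed (use assms(1) in auto)
    finally show "Z -` {d} \<inter> space M \<in> sets M" .
  qed
  have rsi: "rsi n X Y = mass_rsi b n D p"
    unfolding D_def p_def Z_def
    by (rule rsi_eq_mass_rsi) (use fin Z in \<open>simp_all add: D_def Z_def [abs_def]\<close>)
  show ?thesis
    unfolding tendsto_in_probability_def
  proof (intro allI impI)
    fix \<epsilon> :: real assume "\<epsilon> > 0"
    then obtain \<delta> where \<delta>: "\<delta> > 0"
      "\<And>q. (\<And>d. q d \<ge> 0) \<Longrightarrow> (\<And>d. d \<in> D \<Longrightarrow> \<bar>q d - p d\<bar> < \<delta>) \<Longrightarrow>
        \<bar>mass_rsi b n D q - mass_rsi b n D p\<bar> < \<epsilon>"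
      using mass_rsi_modulus[OF b_gt_1] by metis
    let ?Z = "\<lambda>m \<omega>. 1 / real m *
      gen_log_likelihood_ratio b (class_T n A B) (class_H n A B) m (\<lambda>k. S m k \<omega>)"
    let ?P = "\<lambda>m. \<P>(\<omega> in N m. \<bar>?Z m \<omega> - rsi n X Y\<bar> > \<epsilon>)"
    \<comment> \<open>A union bound over the finite alphabet, with one Hoeffding estimate per
      point.\<close>
    have bound: "?P m \<le> card D * (2 * exp (- 2 * m * \<delta>\<^sup>2))" if m: "m \<ge> 1" for m
    proof -
      interpret N: prob_space "N m" using m by (rule assms(7))
      have S: "S m k \<in> measurable (N m) (count_space D)" if "k \<in> {1..m}" for k
        using assms(8)[OF m] that unfolding N.indep_vars_def D_def by blast
      define bad where "bad d = {\<omega>\<in>space (N m).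
        \<delta> \<le> \<bar>(\<Sum>k=1..m. indicator {d} (S m k \<omega>)) / m - p d\<bar>}" for d
      have bad_sets: "bad d \<in> sets (N m)" for d
      proof -
        have [measurable]: "(\<lambda>\<omega>. indicator {d} (S m k \<omega>) :: real) \<in> borel_measurable (N m)"
          if "k \<in> {1..m}" for k
          using S[OF that] by (rule measurable_compose) simp
        show ?thesis unfolding bad_def by measurable
      qed
      \<comment> \<open>Contrapositive of the choice of \<delta>: if every frequency is within
        \<delta> of its probability, the normalised ratio is within \<epsilon> of the index.\<close>
      have "{\<omega>\<in>space (N m). \<bar>?Z m \<omega> - rsi n X Y\<bar> > \<epsilon>} \<subseteq> (\<Union>d\<in>D. bad d)"
      proof
        fix \<omega> assume \<omega>: "\<omega> \<in> {\<omega>\<in>space (N m). \<bar>?Z m \<omega> - rsi n X Y\<bar> > \<epsilon>}"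
        let ?q = "pmf (empirical m (\<lambda>k. S m k \<omega>))"
        have "(\<lambda>k. S m k \<omega>) ` {1..m} \<subseteq> D"
          using measurable_space[OF S] \<omega> by auto
        then have "?Z m \<omega> = mass_rsi b n D ?q"
          unfolding D_def using fin by (intro gen_log_likelihood_ratio_T_H m) (simp_all add: D_def)
        then have "\<not> \<bar>mass_rsi b n D ?q - mass_rsi b n D p\<bar> < \<epsilon>"
          using \<omega> by (simp add: rsi)
        then obtain d where "d \<in> D" "\<not> \<bar>?q d - p d\<bar> < \<delta>"
          using \<delta>(2)[of ?q] by auto
        then show "\<omega> \<in> (\<Union>d\<in>D. bad d)"
          using \<omega> by (auto simp: bad_def pmf_empirical[OF m] not_less)
      qed
      then have "?P m \<le> N.prob (\<Union>d\<in>D. bad d)"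
        using fin bad_sets by (intro N.finite_measure_mono) auto
      also have "\<dots> \<le> (\<Sum>d\<in>D. N.prob (bad d))"
        using fin bad_sets by (intro N.finite_measure_subadditive_finite) auto
      also have "\<dots> \<le> (\<Sum>d\<in>D. 2 * exp (- 2 * m * \<delta>\<^sup>2))"
      proof (rule sum_mono)
        fix d assume d: "d \<in> D"
        have "N.prob (S m k -` {d} \<inter> space (N m)) = p d" if k: "k \<in> {1..m}" for k
        proof -
          have "measure (distr (N m) (count_space D) (S m k)) {d} = measure (distr M (count_space D) Z) {d}"
            using assms(9)[OF m k] by (simp add: D_def Z_def [abs_def])
          then show ?thesis
            using d S[OF k] Z by (simp add: measure_distr p_def)
        qed
        then show "N.prob (bad d) \<le> 2 * exp (- 2 * m * \<delta>\<^sup>2)"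
          unfolding bad_def using assms(8)[OF m] d \<delta>(1) m
          by (intro N.frequency_Hoeffding) (simp_all add: D_def)
      qed
      finally show ?thesis by simp
    qed
    show "?P \<longlonglongrightarrow> 0"
    proof (rule Lim_null_comparison)
      \<comment> \<open>\<open>N 0\<close> is unconstrained, so the bound is claimed from
        \<open>m = 1\<close> on.\<close>
      show "\<forall>\<^sub>F m in sequentially. norm (?P m) \<le> card D * (2 * exp (- 2 * m * \<delta>\<^sup>2))"
        using eventually_ge_at_top[of 1] by eventually_elim (use bound in simp)
      show "(\<lambda>m. card D * (2 * exp (- 2 * m * \<delta>\<^sup>2))) \<longlonglongrightarrow> 0"
        using \<delta>(1) by real_asymp
    qed
  qed
qed

end
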